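(* For every integer $n\geq 2$ and every integer $\ell$ with $8\leq \ell\leq 2^n n!$, the burnt pancake graph $BP_n$ contains a cycle of length $\ell$. In particular, $BP_n$ has a Hamiltonian cycle.
   Context: A signed permutation of $[\pm n]=\{-n,\dots,-1,1,\dots,n\}$ is a bijection $w$ of $[\pm n]$ with $w(-i)=-w(i)$; it is written in window notation $w=[w(1)\,w(2)\,\cdots\,w(n)]$, and $\underline{i}$ denotes $-i$. The group of signed permutations is $B_n$, with $|B_n|=2^n n!$. For $1\leq i\leq n$, the prefix reversal $r_i$ acts on $w$ by $w r_i=[\underline{w(i)}\,\underline{w(i-1)}\cdots\underline{w(1)}\,w(i+1)\cdots w(n)]$ (reverse the first $i$ entries and change their signs). The burnt pancake graph $BP_n$ is the graph with vertex set $B_n$ and an edge between $w$ and $w r_i$ for every $w\in B_n$ and $1\leq i\leq n$ (the Cayley graph of $B_n$ with respect to the prefix reversals). *)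

theory Defs
  imports "HOL-Combinatorics.Permutations" "Graph_Theory.Graph_Theory"
begin

definition pm_interval :: "nat \<Rightarrow> int set" where
  "pm_interval n = {- int n..int n} - {0}"

text \<open>A signed permutation is a total function on the integers which is the identity outside
  \<open>{-n,\<dots>,-1,1,\<dots>,n}\<close> (this is part of \<open>permutes\<close>), so that distinct functions are
  distinct signed permutations.\<close>

definition signed_perms :: "nat \<Rightarrow> (int \<Rightarrow> int) set" where
  "signed_perms n = {w. w permutes pm_interval n \<and> (\<forall>i\<in>pm_interval n. w (- i) = - w i)}"

definition window :: "nat \<Rightarrow> (int \<Rightarrow> int) \<Rightarrow> int list" where
  "window n w = map (\<lambda>j. w (int j)) [1..<Suc n]"

text \<open>\<open>prefix_reversal i w\<close> is \<open>w r\<^sub>i\<close>. The first branch is the window formula; the second is what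
  it forces at negative arguments, since \<open>w r\<^sub>i\<close> is an odd function.\<close>

definition prefix_reversal :: "nat \<Rightarrow> (int \<Rightarrow> int) \<Rightarrow> int \<Rightarrow> int" where
  "prefix_reversal i w = (\<lambda>j.
     if 1 \<le> j \<and> j \<le> int i then - w (int i + 1 - j)
     else if - int i \<le> j \<and> j \<le> - 1 then w (int i + 1 + j)
     else w j)"

lemma window_prefix_reversal:
  assumes "i \<le> n"
  shows "window n (prefix_reversal i w)
    = map uminus (rev (take i (window n w))) @ drop i (window n w)"
  using assms
  by (intro nth_equalityI)
     (auto simp: window_def prefix_reversal_def nth_append rev_nth of_nat_diff algebra_simps
           simp del: upt_Suc)

definition burnt_pancake :: "nat \<Rightarrow> (int \<Rightarrow> int) pair_pre_digraph" where
  "burnt_pancake n = \<lparr>pverts = signed_perms n,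
     parcs = {(w, prefix_reversal i w) | w i. w \<in> signed_perms n \<and> i \<in> {1..n}}\<rparr>"

lemma prefix_reversal_prefix_reversal:
  assumes "w \<in> signed_perms n" "i \<in> {1..n}"
  shows "prefix_reversal i (prefix_reversal i w) = w"
proof
  fix j
  have "w (- k) = - w k" if "k \<in> pm_interval n" for k
    using assms that by (auto simp: signed_perms_def)
  from this[of j] assms(2) show "prefix_reversal i (prefix_reversal i w) j = w j"
    by (auto simp: prefix_reversal_def pm_interval_def)
qed

lemma signed_perms_prefix_reversal:
  assumes w: "w \<in> signed_perms n" and i: "i \<in> {1..n}"
  shows "prefix_reversal i w \<in> signed_perms n"
proof -
  have odd: "w (- j) = - w j" if "j \<in> pm_interval n" for j
    using w that by (auto simp: signed_perms_def)
  have wp: "w permutes pm_interval n" using w by (simp add: signed_perms_def)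
  define r where "r = prefix_reversal i id"
  have rr: "r (r j) = j" for j by (auto simp: r_def prefix_reversal_def)
  have "r permutes pm_interval n"
    unfolding permutes_def
  proof (intro conjI allI impI)
    fix x assume "x \<notin> pm_interval n"
    then show "r x = x" using i by (auto simp: r_def prefix_reversal_def pm_interval_def)
  next
    fix y show "\<exists>!x. r x = y" using rr by metis
  qed
  then have perm: "w \<circ> r permutes pm_interval n" using wp by (rule permutes_compose)
  have eq: "prefix_reversal i w = w \<circ> r"
  proof
    fix j show "prefix_reversal i w j = (w \<circ> r) j"
      using odd[of "int i + 1 - j"] i
      by (auto simp: prefix_reversal_def r_def pm_interval_def algebra_simps)
  qed
  have "prefix_reversal i w (- j) = - prefix_reversal i w j" if "j \<in> pm_interval n" for j
    using odd[OF that] by (auto simp: prefix_reversal_def algebra_simps)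
  then show ?thesis using perm eq by (simp add: signed_perms_def)
qed

lemma prefix_reversal_neq:
  assumes "w \<in> signed_perms n" "i \<in> {1..n}"
  shows "prefix_reversal i w \<noteq> w"
proof
  have wp: "w permutes pm_interval n" using assms by (simp add: signed_perms_def)
  have odd: "- w j = w (- j)" if "j \<in> pm_interval n" for j
    using assms that by (auto simp: signed_perms_def)
  assume "prefix_reversal i w = w"
  then have "- w (int i) = w 1"
    using assms(2) by (auto simp: prefix_reversal_def fun_eq_iff dest: spec[of _ 1])
  then have "w (- int i) = w 1" using odd[of "int i"] assms(2) by (auto simp: pm_interval_def)
  then show False using permutes_inj[OF wp] by (auto dest: injD)
qed

lemma pair_graph_burnt_pancake: "pair_graph (burnt_pancake n)"
proof
  have fin: "finite (signed_perms n)"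
    by (rule finite_subset[OF _ finite_permutations[of "pm_interval n"]])
       (auto simp: signed_perms_def pm_interval_def)
  then show "finite (pverts (burnt_pancake n))" by (simp add: burnt_pancake_def)
  have "parcs (burnt_pancake n) \<subseteq> signed_perms n \<times> signed_perms n"
    using signed_perms_prefix_reversal by (fastforce simp: burnt_pancake_def)
  then show "finite (parcs (burnt_pancake n))" using fin by (meson finite_SigmaI finite_subset)
  have "sym (parcs (burnt_pancake n))"
  proof (rule symI)
    fix a b assume "(a, b) \<in> parcs (burnt_pancake n)"
    then obtain i where *: "b = prefix_reversal i a" "a \<in> signed_perms n" "i \<in> {1..n}"
      by (auto simp: burnt_pancake_def)
    then have "a = prefix_reversal i b" "b \<in> signed_perms n"
      using prefix_reversal_prefix_reversal signed_perms_prefix_reversal by metis+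
    then show "(b, a) \<in> parcs (burnt_pancake n)" using *(3) by (auto simp: burnt_pancake_def)
  qed
  then show "symmetric (with_proj (burnt_pancake n))" by (simp add: symmetric_def)
qed (use signed_perms_prefix_reversal prefix_reversal_neq in \<open>fastforce simp: burnt_pancake_def\<close>)+

text \<open>Undirected graphs are represented as symmetric digraphs, in which traversing one edge back and
  forth is a directed cycle of length 2; the length bound excludes it. A cycle is given by its list
  of arcs, so \<open>length p\<close> is its number of edges.\<close>

definition (in pre_digraph) undirected_cycle :: "'b awalk \<Rightarrow> bool" where
  "undirected_cycle p \<longleftrightarrow> cycle p \<and> 3 \<le> length p"

definition (in pre_digraph) hamiltonian_cycle :: "'b awalk \<Rightarrow> bool" where
  "hamiltonian_cycle p \<longleftrightarrow> undirected_cycle p \<and> tail G ` set p = verts G"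

end

theory Submission
  imports Defs "HOL-Combinatorics.Multiset_Permutations"
begin

text \<open>The induction on \<open>n\<close> maintains a stronger claim: every length \<open>l\<close> in the range is attained by
  a cycle through an \<open>r\<^sub>n\<close>-edge, and by vertex transitivity through any prescribed one. Fixing the
  last entry splits \<open>BP\<^sub>m\<^sub>+\<^sub>1\<close> into \<open>2(m + 1)\<close> copies of \<open>BP\<^sub>m\<close>. The product \<open>r\<^sub>m r\<^sub>m\<^sub>+\<^sub>1\<close> is the signed
  rotation, of order \<open>2(m + 1)\<close>, so alternating these two reversals runs once through all copies,
  traversing in each of them an \<open>r\<^sub>m\<close>-edge. Each of these edges may be replaced by the rest of a
  cycle through it, so all sums of \<open>2(m + 1)\<close> numbers from \<open>{2} \<union> {8..2\<^sup>m m!}\<close> are attained, and these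
  contain every number from \<open>4(m + 1) + 6\<close> on. Shorter lengths are inherited from \<open>BP\<^sub>m\<close> through the
  embedding that replaces the entry \<open>1\<close> by the block \<open>1 2\<close>; unlike the embedding as a copy, it
  sends \<open>r\<^sub>m\<close>-edges to \<open>r\<^sub>m\<^sub>+\<^sub>1\<close>-edges. The induction starts at \<open>m = 3\<close> with explicit cycles, since in
  \<open>BP\<^sub>2\<close> only the length \<open>8\<close> is available.\<close>

section \<open>Prefix flips of windows, trajectories and closable words\<close>

definition prefix_flip :: "nat \<Rightarrow> int list \<Rightarrow> int list" where
  "prefix_flip i xs = map uminus (rev (take i xs)) @ drop i xs"

fun traj :: "int list \<Rightarrow> nat list \<Rightarrow> int list list" where
  "traj xs [] = [xs]"
| "traj xs (i # ws) = xs # traj (prefix_flip i xs) ws"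

definition id_window :: "nat \<Rightarrow> int list" where
  "id_window m = map int [1..<Suc m]"

text \<open>A closable word describes a cycle through an \<open>r\<^sub>m\<close>-edge by the remaining edges of the cycle.\<close>

definition closable_word :: "nat \<Rightarrow> nat list \<Rightarrow> bool" where
  "closable_word m ws \<longleftrightarrow> set ws \<subseteq> {1..m} \<and> distinct (traj (id_window m) ws)
     \<and> last (traj (id_window m) ws) = prefix_flip m (id_window m)"

text \<open>The length \<open>2\<close> is deliberately included: the word \<open>[m]\<close> traverses the closing edge itself.\<close>

definition cycle_length :: "nat \<Rightarrow> nat \<Rightarrow> bool" where
  "cycle_length m l \<longleftrightarrow> (\<exists>ws. closable_word m ws \<and> Suc (length ws) = l)"

lemma length_prefix_flip [simp]: "length (prefix_flip i xs) = length xs"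
  by (simp add: prefix_flip_def)

lemma prefix_flip_prefix_flip: "i \<le> length xs \<Longrightarrow> prefix_flip i (prefix_flip i xs) = xs"
  by (simp add: prefix_flip_def rev_map o_def)

lemma prefix_flip_append: "i \<le> length xs \<Longrightarrow> prefix_flip i (xs @ ys) = prefix_flip i xs @ ys"
  by (simp add: prefix_flip_def)

lemma prefix_flip_map: "(\<And>k. f (- k) = - f k) \<Longrightarrow> prefix_flip i (map f xs) = map f (prefix_flip i xs)"
  by (simp add: prefix_flip_def take_map drop_map rev_map)

lemma abs_set_prefix_flip: "abs ` set (prefix_flip i xs) = abs ` set xs"
proof -
  have "abs ` set (prefix_flip i xs) = abs ` set (take i xs @ drop i xs)"
    unfolding prefix_flip_def set_append image_Un by (simp add: image_image)
  then show ?thesis by simp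
qed

lemma traj_not_Nil [simp]: "traj xs ws \<noteq> []"
  by (cases ws) auto

lemma traj_append_Cons:
  "traj xs (vs @ i # ws) = traj xs vs @ traj (prefix_flip i (last (traj xs vs))) ws"
  by (induction vs arbitrary: xs) auto

lemma traj_map: "(\<And>k. f (- k) = - f k) \<Longrightarrow> traj (map f xs) ws = map (map f) (traj xs ws)"
  by (induction ws arbitrary: xs) (auto simp: prefix_flip_map)

lemma traj_append:
  "set ws \<subseteq> {..length xs} \<Longrightarrow> traj (xs @ ys) ws = map (\<lambda>zs. zs @ ys) (traj xs ws)"
  by (induction ws arbitrary: xs) (auto simp: prefix_flip_append)

lemma abs_set_traj: "zs \<in> set (traj xs ws) \<Longrightarrow> abs ` set zs = abs ` set xs"
proof (induction ws arbitrary: xs)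
  case (Cons i ws)
  then show ?case using abs_set_prefix_flip[of i xs] by fastforce
qed simp

lemma length_id_window [simp]: "length (id_window m) = m"
  by (simp add: id_window_def)

lemma abs_set_id_window: "abs ` set (id_window m) = {1..int m}"
proof -
  have "set (id_window m) = int ` {1..m}" by (auto simp: id_window_def simp del: upt_Suc)
  then show ?thesis by (simp only: image_image abs_of_nat image_int_atLeastAtMost) simp
qed

section \<open>Relabelling the entries: vertex transitivity\<close>

definition generic :: "int list \<Rightarrow> bool" where
  "generic xs \<longleftrightarrow> distinct (map abs xs) \<and> 0 \<notin> set xs"

lemma generic_id_window: "generic (id_window m)"
  by (auto simp: generic_def id_window_def distinct_map inj_on_def simp del: upt_Suc)

text \<open>Left multiplication by the signed permutation with window \<open>xs\<close>, an odd
  function on values. Since \<open>sgn 0 = 0\<close>, oddness holds at every integer without side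
  conditions.\<close>

definition relabel :: "int list \<Rightarrow> int \<Rightarrow> int" where
  "relabel xs k = sgn k * xs ! nat (\<bar>k\<bar> - 1)"

lemma relabel_minus: "relabel xs (- k) = - relabel xs k"
  by (simp add: relabel_def sgn_minus)

lemma map_relabel_id_window: "map (relabel xs) (id_window (length xs)) = xs"
  by (rule nth_equalityI) (auto simp: id_window_def relabel_def simp del: upt_Suc)

text \<open>The absolute value of the image determines the position, as absolute values in
  \<open>xs\<close> are distinct; the entry there is nonzero, so the sign is determined too.\<close>

lemma inj_on_relabel:
  assumes "generic xs"
  shows "inj_on (relabel xs) {k. \<bar>k\<bar> \<in> {1..int (length xs)}}"
proof (rule inj_onI, clarsimp)
  fix a b :: int
  assume a: "1 \<le> \<bar>a\<bar>" "\<bar>a\<bar> \<le> int (length xs)" and b: "1 \<le> \<bar>b\<bar>" "\<bar>b\<bar> \<le> int (length xs)"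
    and eq: "relabel xs a = relabel xs b"
  define i j where ij: "i = nat (\<bar>a\<bar> - 1)" "j = nat (\<bar>b\<bar> - 1)"
  have len: "i < length xs" "j < length xs" using a b by (auto simp: ij)
  have eq': "sgn a * xs ! i = sgn b * xs ! j" using eq by (simp add: relabel_def ij)
  have "\<bar>sgn a * xs ! i\<bar> = \<bar>xs ! i\<bar>" "\<bar>sgn b * xs ! j\<bar> = \<bar>xs ! j\<bar>"
    using a b by (auto simp: abs_mult)
  then have "map abs xs ! i = map abs xs ! j" using eq' len by simp
  then have "i = j"
    using assms len by (metis generic_def length_map nth_eq_iff_index_eq)
  then have "\<bar>a\<bar> = \<bar>b\<bar>" using a b unfolding ij by linarith
  moreover have "xs ! i \<noteq> 0" using assms len by (metis generic_def nth_mem)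
  then have "sgn a = sgn b" using eq' \<open>i = j\<close> by simp
  ultimately show "a = b" by (metis mult_sgn_abs)
qed

text \<open>Flips permute positions and change signs, so they commute with the odd map
  \<open>relabel xs\<close> on values. The trajectory from \<open>xs\<close> is thus the injective
  image of the one from \<open>id_window m\<close>.\<close>

lemma closable_wordD:
  assumes "closable_word m ws" "generic xs" "length xs = m"
  shows "distinct (traj xs ws)" "last (traj xs ws) = prefix_flip m xs"
proof -
  let ?f = "relabel xs" and ?t = "traj (id_window m) ws"
  have t: "traj xs ws = map (map ?f) ?t"
    using traj_map[of ?f "id_window m" ws] map_relabel_id_window[of xs] relabel_minus assms(3)
    by simp
  have "\<Union> (set ` set ?t) \<subseteq> {k. \<bar>k\<bar> \<in> {1..int (length xs)}}"
    using abs_set_traj[of _ "id_window m" ws] abs_set_id_window[of m] assms(3) by blast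
  then have "inj_on (map ?f) (set ?t)"
    by (rule inj_on_mapI[OF inj_on_subset[OF inj_on_relabel[OF assms(2)]]])
  then show "distinct (traj xs ws)"
    using assms(1) by (simp add: t distinct_map closable_word_def)
  have "last (traj xs ws) = map ?f (prefix_flip m (id_window m))"
    using assms(1) by (simp add: t last_map closable_word_def)
  also have "\<dots> = prefix_flip m xs"
    using prefix_flip_map[of ?f m "id_window m"] map_relabel_id_window[of xs] relabel_minus assms(3) by simp
  finally show "last (traj xs ws) = prefix_flip m xs" .
qed

subsection \<open>Joining the copies of the smaller graph\<close>

text \<open>The signed rotation, written as the two flips that lead from the entry vertex of one
  copy to the entry vertex of the next.\<close>

definition rot :: "int list \<Rightarrow> int list" where
  "rot xs = prefix_flip (length xs) (prefix_flip (length xs - 1) xs)"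

lemma rot_snoc: "rot (xs @ [a]) = - a # xs"
  by (simp add: rot_def prefix_flip_def rev_map o_def)

lemma length_rot [simp]: "length (rot xs) = length xs"
  by (simp add: rot_def)

lemma length_funpow_rot [simp]: "length ((rot ^^ k) xs) = length xs"
  by (induction k) auto

lemma generic_rot: "generic xs \<Longrightarrow> generic (rot xs)"
  by (cases xs rule: rev_cases) (auto simp: generic_def rot_snoc rot_def[of "[]"] prefix_flip_def o_def)

lemma funpow_rot_append: "(rot ^^ length ys) (xs @ ys) = map uminus ys @ xs"
proof (induction ys arbitrary: xs rule: rev_induct)
  case (snoc b ys)
  have "(rot ^^ length (ys @ [b])) (xs @ ys @ [b]) = (rot ^^ length ys) (rot ((xs @ ys) @ [b]))"
    by (simp add: funpow_swap1)
  also have "\<dots> = map uminus ys @ (- b # xs)"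
    using snoc[of "- b # xs"] by (simp only: rot_snoc append_Cons)
  finally show ?case by simp
qed auto

lemma last_funpow_rot:
  assumes "k < length xs"
  shows "last ((rot ^^ k) xs) = xs ! (length xs - Suc k)"
proof -
  have "(rot ^^ k) xs = map uminus (drop (length xs - k) xs) @ take (length xs - k) xs"
    using funpow_rot_append[of "drop (length xs - k) xs" "take (length xs - k) xs"] assms by simp
  moreover have "take (length xs - k) xs \<noteq> []" using assms by auto
  ultimately have "last ((rot ^^ k) xs) = last (take (length xs - k) xs)" by simp
  also have "\<dots> = xs ! (length xs - Suc k)" using assms by (subst last_conv_nth) auto
  finally show ?thesis .
qed

lemma funpow_rot_length: "(rot ^^ length xs) xs = map uminus xs"
  using funpow_rot_append[of xs "[]"] by simp

text \<open>The copies are labelled by last entries. They are met in the order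
  \<open>n, ..., 1, -n, ..., -1\<close>, because \<open>n\<close> rotations negate the whole
  window.\<close>

lemma last_funpow_rot_id_window:
  assumes "k < 2 * n"
  shows "last ((rot ^^ k) (id_window n)) = (if k < n then int n - int k else int k - 2 * int n)"
proof (cases "k < n")
  case True
  then show ?thesis using last_funpow_rot[of k "id_window n"]
    by (auto simp: id_window_def simp del: upt_Suc)
next
  case False
  have "(rot ^^ k) (id_window n) = (rot ^^ (k - n)) ((rot ^^ n) (id_window n))"
    using False by (metis comp_apply funpow_add le_add_diff_inverse2 not_le)
  also have "(rot ^^ n) (id_window n) = map uminus (id_window n)"
    using funpow_rot_length[of "id_window n"] by simp
  finally show ?thesis
    using False assms last_funpow_rot[of "k - n" "map uminus (id_window n)"]
    by (auto simp: id_window_def simp del: upt_Suc)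
qed

text \<open>Separators \<open>n\<close> stand between the words only: the last \<open>n\<close>-edge
  is the closing edge of the large cycle and belongs to no closable word.\<close>

fun join_words :: "nat \<Rightarrow> nat list list \<Rightarrow> nat list" where
  "join_words n [] = []"
| "join_words n [ws] = ws"
| "join_words n (ws # Ws) = ws @ n # join_words n Ws"

text \<open>Separators and closing edge together supply one further edge per word, so cycle lengths
  simply add up.\<close>

lemma length_join_words:
  "Ws \<noteq> [] \<Longrightarrow> Suc (length (join_words n Ws)) = sum_list (map (\<lambda>ws. Suc (length ws)) Ws)"
  by (induction n Ws rule: join_words.induct) auto

lemma set_join_words:
  "\<forall>ws\<in>set Ws. set ws \<subseteq> {1..m} \<Longrightarrow> set (join_words (Suc m) Ws) \<subseteq> {1..Suc m}"
  by (induction "Suc m" Ws rule: join_words.induct) auto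

text \<open>Letters up to \<open>m\<close> never touch the last entry, so the trajectory stays
  within one copy and is there a trajectory of the first \<open>m\<close> entries.\<close>

lemma closable_word_lift:
  assumes "closable_word m ws" "generic xs" "length xs = Suc m"
  shows "distinct (traj xs ws)" "last (traj xs ws) = prefix_flip m xs" "last ` set (traj xs ws) = {last xs}"
proof -
  obtain us a where xs: "xs = us @ [a]" using assms(3) by (cases xs rule: rev_cases) auto
  \<comment> \<open>Deleting an entry preserves genericity, although the values of \<open>us\<close>
    need not be \<open>1\<close>, ..., \<open>m\<close> up to sign.\<close>
  have us: "generic us" "length us = m" using assms by (auto simp: xs generic_def)
  have "set ws \<subseteq> {..length us}" using assms(1) us by (auto simp: closable_word_def)
  then have t: "traj xs ws = map (\<lambda>zs. zs @ [a]) (traj us ws)" by (simp add: xs traj_append)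
  note * = closable_wordD[OF assms(1) us]
  show "distinct (traj xs ws)" using *(1) by (simp add: t distinct_map inj_on_def)
  show "last (traj xs ws) = prefix_flip m xs" unfolding t using *(2) us by (simp add: last_map prefix_flip_append xs)
  show "last ` set (traj xs ws) = {last xs}"
    unfolding t by (simp add: xs image_image image_constant_conv)
qed

text \<open>Induction on the words: after the first word and a separator the walk continues from
  \<open>rot xs\<close>, in the next copy. Copies with different last entries are disjoint, so
  distinct labels give a distinct trajectory.\<close>

lemma traj_join_words:
  assumes "Ws \<noteq> []" "\<forall>ws\<in>set Ws. closable_word m ws" "generic xs" "length xs = Suc m"
  shows "last ` set (traj xs (join_words (Suc m) Ws)) = (\<lambda>k. last ((rot ^^ k) xs)) ` {..<length Ws}
     \<and> last (traj xs (join_words (Suc m) Ws)) = prefix_flip m ((rot ^^ (length Ws - 1)) xs)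
     \<and> (inj_on (\<lambda>k. last ((rot ^^ k) xs)) {..<length Ws}
          \<longrightarrow> distinct (traj xs (join_words (Suc m) Ws)))"
  using assms
proof (induction "Suc m" Ws arbitrary: xs rule: join_words.induct)
  case (2 ws)
  then show ?case using closable_word_lift[of m ws xs] by (simp add: lessThan_Suc)
next
  case (3 ws v Vs)
  let ?Ws = "v # Vs" and ?L = "\<lambda>xs k. last ((rot ^^ k) xs)"
  note lift = closable_word_lift[of m ws xs]
  have rot: "prefix_flip (Suc m) (last (traj xs ws)) = rot xs"
    using lift "3.prems" by (simp add: rot_def)
  have t: "traj xs (join_words (Suc m) (ws # ?Ws))
      = traj xs ws @ traj (rot xs) (join_words (Suc m) ?Ws)"
    by (simp add: traj_append_Cons rot)
  have IH: "last ` set (traj (rot xs) (join_words (Suc m) ?Ws)) = ?L (rot xs) ` {..<length ?Ws}"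
    "last (traj (rot xs) (join_words (Suc m) ?Ws)) = prefix_flip m ((rot ^^ (length ?Ws - 1)) (rot xs))"
    "inj_on (?L (rot xs)) {..<length ?Ws} \<Longrightarrow> distinct (traj (rot xs) (join_words (Suc m) ?Ws))"
    using "3.hyps"[of "rot xs"] "3.prems" generic_rot by auto
  have shift: "?L (rot xs) = ?L xs \<circ> Suc" by (auto simp: funpow_swap1)
  have rng: "{..<length (ws # ?Ws)} = insert 0 (Suc ` {..<length ?Ws})"
    by (simp only: length_Cons lessThan_Suc_eq_insert_0)
  have lasts: "?L (rot xs) ` {..<length ?Ws} = ?L xs ` Suc ` {..<length ?Ws}"
    unfolding shift by (simp only: image_comp)
  have 1: "last ` set (traj xs (join_words (Suc m) (ws # ?Ws))) = ?L xs ` {..<length (ws # ?Ws)}"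
    unfolding t rng set_append image_Un IH(1) lasts using lift(3) "3.prems" by simp
  have 2: "last (traj xs (join_words (Suc m) (ws # ?Ws)))
      = prefix_flip m ((rot ^^ (length (ws # ?Ws) - 1)) xs)"
    unfolding t using IH(2) by (simp add: funpow_swap1)
  have 3: "distinct (traj xs (join_words (Suc m) (ws # ?Ws)))"
    if inj: "inj_on (?L xs) {..<length (ws # ?Ws)}"
  proof -
    have "inj_on (?L xs) (Suc ` {..<length ?Ws})"
      using inj unfolding rng by (rule inj_on_subset) blast
    then have dist: "inj_on (?L (rot xs)) {..<length ?Ws}"
      unfolding shift by (intro comp_inj_on) auto
    have "?L xs 0 \<notin> ?L xs ` Suc ` {..<length ?Ws}"
      using inj unfolding rng by (simp add: inj_on_insert)
    moreover have "last ` set (traj xs ws) = {?L xs 0}"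
      using lift(3) "3.prems" by simp
    moreover have "last ` set (traj (rot xs) (join_words (Suc m) ?Ws))
        = ?L xs ` Suc ` {..<length ?Ws}"
      using IH(1) unfolding lasts .
    \<comment> \<open>To be used with \<open>last\<close> for \<open>f\<close>: vertices of
      different copies differ in their last entry.\<close>
    moreover have "X \<inter> Y = {}" if "f ` X = {a}" "f ` Y = B" "a \<notin> B"
      for f :: "int list \<Rightarrow> int" and X Y a B
      using that by auto
    ultimately have disj: "set (traj xs ws) \<inter> set (traj (rot xs) (join_words (Suc m) ?Ws)) = {}"
      by (metis (no_types))
    show ?thesis unfolding t using IH(3) dist disj lift(1) "3.prems" by simp
  qed
  show ?case using 1 2 3 by blast
qed auto

lemma closable_word_join_words:
  assumes "length Ws = 2 * Suc m" "\<forall>ws\<in>set Ws. closable_word m ws"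
  shows "closable_word (Suc m) (join_words (Suc m) Ws)"
proof -
  let ?u = "id_window (Suc m)"
  have inj: "inj_on (\<lambda>k. last ((rot ^^ k) ?u)) {..<length Ws}"
    by (rule inj_onI) (auto simp: assms(1) last_funpow_rot_id_window split: if_splits)
  have Ws: "Ws \<noteq> []" using assms(1) by auto
  note * = traj_join_words[OF Ws assms(2) generic_id_window length_id_window]
  define y where "y = (rot ^^ (length Ws - 1)) ?u"
  \<comment> \<open>The walk ends one flip short of a full turn, which consists of two half turns
    that each negate the window.\<close>
  have "prefix_flip (Suc m) (prefix_flip m y) = rot y" by (simp add: rot_def y_def)
  also have "rot y = (rot ^^ (Suc m + Suc m)) ?u"
    unfolding y_def assms(1) by (simp add: mult_2)
  also have "\<dots> = (rot ^^ Suc m) ((rot ^^ Suc m) ?u)" by (simp only: funpow_add comp_apply)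
  also have "\<dots> = ?u"
    using funpow_rot_length[of ?u] funpow_rot_length[of "map uminus ?u"]
    by (simp add: o_def del: funpow.simps)
  finally have "prefix_flip m y = prefix_flip (Suc m) ?u"
    using prefix_flip_prefix_flip[of "Suc m" "prefix_flip m y"] by (simp add: y_def)
  then show ?thesis
    using * inj set_join_words[of Ws m] assms(2) by (auto simp: closable_word_def y_def)
qed

lemma cycle_length_2: "m \<ge> 1 \<Longrightarrow> cycle_length m 2"
proof -
  assume m: "m \<ge> 1"
  have "prefix_flip m (id_window m) \<noteq> id_window m"
  proof
    assume "prefix_flip m (id_window m) = id_window m"
    then have "set (prefix_flip m (id_window m)) = set (id_window m)" by simp
    moreover have "- 1 \<in> set (prefix_flip m (id_window m))"
      using m by (force simp: prefix_flip_def id_window_def simp del: upt_Suc)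
    ultimately show False by (auto simp: id_window_def simp del: upt_Suc)
  qed
  then have "closable_word m [m]" using m by (auto simp: closable_word_def)
  then show ?thesis by (auto simp: cycle_length_def intro!: exI[of _ "[m]"])
qed

lemma cycle_length_sum_list:
  assumes "length cs = 2 * Suc m" "\<forall>c\<in>set cs. cycle_length m c"
  shows "cycle_length (Suc m) (sum_list cs)"
proof -
  obtain f where f: "\<forall>c\<in>set cs. closable_word m (f c) \<and> Suc (length (f c)) = c"
    using assms(2) unfolding cycle_length_def by metis
  have "map (\<lambda>c. Suc (length (f c))) cs = cs" using f by (simp add: map_idI)
  then have "Suc (length (join_words (Suc m) (map f cs))) = sum_list cs"
    using length_join_words[of "map f cs" "Suc m"] assms(1) by (cases cs) (auto simp: o_def)
  moreover have "closable_word (Suc m) (join_words (Suc m) (map f cs))"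
    using f assms(1) by (intro closable_word_join_words) auto
  ultimately show ?thesis unfolding cycle_length_def by blast
qed

text \<open>The lower bound is \<open>8 + 2 * (k - 1)\<close>. Induction on \<open>k\<close> removes
  one summand and keeps the remainder between \<open>2 * k + 6\<close> and
  \<open>k * N\<close>.\<close>

lemma sum_list_decomposition:
  assumes "13 \<le> N" "1 \<le> k" "2 * k + 6 \<le> l" "l \<le> k * N"
  shows "\<exists>cs. length cs = k \<and> set cs \<subseteq> insert 2 {8..N} \<and> sum_list cs = l"
  using assms(2-)
proof (induction k arbitrary: l rule: dec_induct)
  case base
  then show ?case by (intro exI[of _ "[l]"]) auto
next
  case (step k)
  have extend: ?case if c: "c \<in> insert 2 {8..N}" "c \<le> l" "2 * k + 6 \<le> l - c" "l - c \<le> k * N" for c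
  proof -
    obtain cs where "length cs = k" "set cs \<subseteq> insert 2 {8..N}" "sum_list cs = l - c"
      using step.IH[of "l - c"] c by blast
    then show ?thesis using c by (intro exI[of _ "c # cs"]) auto
  qed
  have "k * 13 \<le> k * N" using assms(1) by simp
  \<comment> \<open>Removing \<open>8\<close> from a number above \<open>k * N + 2\<close> leaves at
    least \<open>k * N - 5\<close>, which must reach \<open>2 * k + 6\<close>. At
    \<open>k = 1\<close> this asks for \<open>N\<close> to be at least \<open>13\<close>.\<close>
  then have kN: "2 * k + 11 \<le> k * N" using step.hyps by linarith
  consider "l \<le> k * N + 2" | "k * N + 2 < l" "l \<le> k * N + 8" | "k * N + 8 < l" by linarith
  then show ?case
  proof cases
    case 1
    then show ?thesis using step.prems by (intro extend[of 2]) auto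
  next
    case 2
    then show ?thesis using kN assms(1) by (intro extend[of 8]) auto
  next
    case 3
    then show ?thesis using kN step.prems by (intro extend[of "l - k * N"]) auto
  qed
qed

subsection \<open>Doubling the first entry\<close>

text \<open>The block \<open>1 2\<close>, reversed and negated, is \<open>-2 -1\<close>, the image
  of \<open>-1\<close>; hence it moves like a single entry. The other nonzero entries move away from
  \<open>0\<close> to make room for \<open>2\<close>.\<close>

definition split_entry :: "int \<Rightarrow> int list" where
  "split_entry k = (if k = 1 then [1, 2] else if k = - 1 then [- 2, - 1] else [k + sgn k])"

definition split_one :: "int list \<Rightarrow> int list" where
  "split_one xs = concat (map split_entry xs)"

text \<open>A left inverse of \<open>split_one\<close>, introduced to prove its injectivity.\<close>

definition merge_one :: "int list \<Rightarrow> int list" where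
  "merge_one xs = map (\<lambda>k. if \<bar>k\<bar> = 1 then k else k - sgn k) (filter (\<lambda>k. \<bar>k\<bar> \<noteq> 2) xs)"

lemma merge_split_one: "0 \<notin> set xs \<Longrightarrow> merge_one (split_one xs) = xs"
  by (induction xs) (auto simp: merge_one_def split_one_def split_entry_def sgn_if)

lemma split_one_append: "split_one (xs @ ys) = split_one xs @ split_one ys"
  by (simp add: split_one_def)

lemma split_one_neg_rev: "split_one (map uminus (rev xs)) = map uminus (rev (split_one xs))"
  by (induction xs) (auto simp: split_one_def split_entry_def sgn_if)

text \<open>A cut after the images of the first \<open>i\<close> entries never falls inside a block,
  so edges go to edges.\<close>

lemma prefix_flip_split_one: "prefix_flip (length (split_one (take i xs))) (split_one xs) = split_one (prefix_flip i xs)"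
proof -
  have "split_one xs = split_one (take i xs) @ split_one (drop i xs)"
    by (simp flip: split_one_append)
  then show ?thesis by (simp add: prefix_flip_def split_one_append split_one_neg_rev)
qed

lemma split_entry_not_Nil: "split_entry k \<noteq> []"
  by (simp add: split_entry_def)

text \<open>The image of an edge has its index raised by one or not according to whether the block
  lies in the flipped prefix. The word \<open>vs\<close> therefore depends on the vertices visited,
  not on \<open>ws\<close> alone.\<close>

lemma traj_split_one:
  assumes "set ws \<subseteq> {1..m}" "xs \<noteq> []" "length (split_one xs) = n"
  shows "\<exists>vs. length vs = length ws \<and> set vs \<subseteq> {1..n}
    \<and> traj (split_one xs) vs = map split_one (traj xs ws)"
  using assms
proof (induction ws arbitrary: xs)
  case (Cons i ws)
  let ?j = "length (split_one (take i xs))"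
  have prefix_flip: "prefix_flip ?j (split_one xs) = split_one (prefix_flip i xs)" by (rule prefix_flip_split_one)
  have "length (split_one (prefix_flip i xs)) = n" unfolding prefix_flip[symmetric] using Cons.prems by simp
  moreover have "prefix_flip i xs \<noteq> []" using Cons.prems by (metis length_0_conv length_prefix_flip)
  ultimately obtain vs where vs: "length vs = length ws" "set vs \<subseteq> {1..n}"
    "traj (split_one (prefix_flip i xs)) vs = map split_one (traj (prefix_flip i xs) ws)"
    using Cons.IH[of "prefix_flip i xs"] Cons.prems by auto
  have "split_one (take i xs) \<noteq> []"
    using Cons.prems by (cases xs; cases i) (auto simp: split_one_def split_entry_not_Nil)
  moreover have "?j \<le> length (split_one (take i xs)) + length (split_one (drop i xs))" by simp
  then have "?j \<le> n" using Cons.prems(3) by (metis append_take_drop_id length_append split_one_append)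
  ultimately have "?j \<in> {1..n}" by (simp add: Suc_leI)
  then show ?case using vs by (intro exI[of _ "?j # vs"]) (auto simp: prefix_flip)
qed auto

lemma split_one_id_window:
  assumes "m \<ge> 1"
  shows "split_one (id_window m) = id_window (Suc m)"
  using assms
proof (induction m rule: dec_induct)
  case (step k)
  have snoc: "id_window (Suc j) = id_window j @ [int (Suc j)]" for j
    by (simp add: id_window_def)
  have "split_one [int (Suc k)] = [int (Suc (Suc k))]"
    using step.hyps by (simp add: split_one_def split_entry_def)
  then show ?case using step.IH by (simp only: snoc[of "Suc k"] snoc[of k] split_one_append)
qed (simp add: id_window_def split_one_def split_entry_def)

lemma cycle_length_Suc:
  assumes "cycle_length m l" "m \<ge> 1"
  shows "cycle_length (Suc m) l"
proof -
  obtain ws where ws: "closable_word m ws" "Suc (length ws) = l"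
    using assms(1) by (auto simp: cycle_length_def)
  have split: "split_one (id_window m) = id_window (Suc m)"
    using split_one_id_window assms(2) by blast
  obtain vs where vs: "length vs = length ws" "set vs \<subseteq> {1..Suc m}"
    "traj (id_window (Suc m)) vs = map split_one (traj (id_window m) ws)"
  proof -
    have "set ws \<subseteq> {1..m}" using ws(1) by (simp add: closable_word_def)
    moreover have "id_window m \<noteq> []" using assms(2) by (simp add: id_window_def)
    moreover have "length (split_one (id_window m)) = Suc m" by (simp add: split)
    ultimately show ?thesis using traj_split_one[of ws m "id_window m" "Suc m"] that
      unfolding split by blast
  qed
  have "inj_on split_one (set (traj (id_window m) ws))"
  proof (rule inj_on_inverseI)
    fix zs assume "zs \<in> set (traj (id_window m) ws)"
    then have "abs ` set zs = {1..int m}" using abs_set_traj abs_set_id_window by metis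
    then have "0 \<notin> set zs" by force
    then show "merge_one (split_one zs) = zs" by (rule merge_split_one)
  qed
  then have "distinct (traj (id_window (Suc m)) vs)"
    using ws(1) by (simp add: vs(3) distinct_map closable_word_def)
  moreover have "last (traj (id_window (Suc m)) vs) = split_one (prefix_flip m (id_window m))"
    using ws(1) by (simp add: vs(3) last_map closable_word_def)
  \<comment> \<open>The prefix of length \<open>m\<close> is the whole window, so its image is the
    whole larger window: the closing edge becomes a closing edge.\<close>
  then have "last (traj (id_window (Suc m)) vs) = prefix_flip (Suc m) (id_window (Suc m))"
    using prefix_flip_split_one[of m "id_window m"] split by simp
  ultimately have "closable_word (Suc m) vs" using vs(2) by (simp add: closable_word_def)
  then show ?thesis using vs(1) ws(2) by (auto simp: cycle_length_def)
qed

subsection \<open>All cycle lengths\<close>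

text \<open>Certificates to be checked by evaluation: one word for each length from 7 to 47, the
  closing edge \<open>3\<close> completing cycles of lengths 8 to 48, where 48 is the order of the
  graph.\<close>

definition words3 :: "nat list list" where
  "words3 =
    [[2, 3, 1, 3, 2, 3, 1],
     [1, 2, 3, 1, 2, 3, 1, 2],
     [2, 1, 3, 1, 3, 1, 2, 3, 1],
     [1, 3, 1, 3, 2, 1, 3, 2, 3, 2],
     [2, 3, 2, 3, 2, 3, 2, 3, 2, 3, 2],
     [1, 2, 3, 1, 3, 1, 3, 1, 2, 3, 2, 1],
     [1, 3, 2, 3, 1, 2, 3, 1, 3, 2, 3, 1, 2],
     [1, 3, 2, 1, 2, 1, 2, 3, 2, 1, 3, 2, 3, 1],
     [1, 3, 2, 3, 1, 3, 1, 2, 1, 3, 2, 1, 2, 3, 1],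
     [1, 3, 1, 3, 2, 3, 2, 3, 1, 3, 2, 1, 2, 3, 2, 1],
     [2, 1, 2, 1, 2, 3, 2, 3, 2, 3, 2, 1, 3, 2, 1, 3, 2],
     [1, 3, 1, 2, 1, 2, 3, 1, 2, 1, 3, 1, 2, 1, 3, 1, 2, 1],
     [1, 2, 1, 3, 1, 2, 3, 1, 2, 1, 2, 3, 2, 1, 3, 2, 1, 3, 1],
     [1, 3, 1, 2, 1, 3, 2, 3, 1, 2, 3, 1, 3, 1, 2, 1, 2, 1, 3, 1],
     [1, 3, 2, 1, 2, 1, 3, 1, 2, 3, 1, 2, 1, 2, 3, 2, 1, 3, 2, 1, 2],
     [2, 1, 2, 3, 1, 3, 1, 3, 2, 3, 1, 3, 1, 2, 3, 1, 2, 1, 3, 2, 3, 2],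
     [2, 1, 2, 1, 2, 3, 2, 1, 2, 1, 3, 1, 3, 1, 2, 1, 2, 1, 3, 2, 1, 3, 1],
     [1, 3, 1, 3, 2, 3, 2, 1, 3, 2, 1, 2, 1, 3, 2, 3, 2, 1, 2, 3, 1, 2, 3, 2],
     [2, 1, 3, 2, 1, 2, 1, 2, 3, 1, 2, 1, 3, 2, 1, 3, 1, 2, 3, 1, 2, 3, 1, 3, 1],
     [2, 3, 1, 3, 2, 3, 2, 1, 3, 1, 3, 2, 1, 3, 1, 2, 3, 2, 3, 2, 1, 2, 3, 1, 3, 2],
     [2, 1, 2, 3, 1, 2, 3, 1, 3, 2, 1, 2, 1, 2, 3, 2, 1, 3, 1, 3, 2, 1, 2, 1, 2, 3, 1],
     [1, 2, 1, 2, 3, 2, 1, 3, 2, 3, 2, 1, 3, 2, 3, 1, 3, 2, 1, 2, 1, 3, 2, 1, 2, 3, 2, 1],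
     [2, 1, 3, 1, 2, 3, 1, 2, 3, 1, 3, 1, 2, 1, 3, 1, 3, 1, 2, 3, 1, 2, 1, 3, 2, 1, 3, 1, 2],
     [2, 1, 2, 1, 3, 2, 3, 2, 1, 2, 3, 1, 3, 2, 1, 2, 1, 3, 1, 2, 1, 2, 3, 2, 1, 3, 2, 1, 3, 1],
     [2, 3, 1, 3, 1, 3, 2, 1, 3, 1, 2, 1, 3, 1, 2, 3, 1, 2, 1, 3, 1, 2, 1, 2, 1, 2, 1, 3, 1, 3,
     1],
     [1, 2, 1, 3, 2, 1, 3, 2, 3, 2, 3, 2, 1, 3, 1, 3, 1, 2, 3, 2, 1, 2, 1, 3, 1, 3, 1, 2, 3, 2,
     1, 2],
     [2, 3, 1, 3, 1, 3, 1, 2, 3, 1, 3, 1, 3, 2, 1, 3, 1, 3, 2, 3, 1, 2, 1, 3, 1, 3, 1, 3, 1, 2,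
     1, 3, 1],
     [2, 3, 2, 1, 2, 3, 1, 3, 1, 3, 1, 2, 1, 2, 1, 2, 3, 2, 1, 3, 1, 3, 1, 2, 1, 3, 1, 2, 3, 1,
     2, 1, 3, 2],
     [1, 3, 2, 3, 2, 1, 3, 1, 3, 2, 1, 2, 1, 3, 2, 1, 2, 3, 2, 1, 3, 2, 3, 1, 3, 1, 2, 1, 3, 1,
     2, 1, 2, 3, 2],
     [1, 3, 2, 3, 2, 1, 2, 1, 3, 1, 2, 3, 2, 1, 2, 1, 2, 1, 3, 1, 3, 2, 1, 2, 1, 3, 2, 3, 2, 1,
     2, 3, 1, 3, 1, 2],
     [1, 2, 3, 2, 1, 3, 2, 3, 2, 1, 3, 2, 3, 1, 3, 1, 3, 1, 2, 3, 1, 2, 3, 1, 3, 2, 3, 2, 1, 3,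
     1, 3, 2, 3, 1, 3, 1],
     [1, 2, 3, 1, 2, 1, 3, 2, 1, 3, 2, 1, 2, 3, 2, 3, 2, 1, 3, 2, 3, 1, 2, 1, 3, 2, 1, 3, 2, 1,
     2, 1, 3, 1, 3, 2, 3, 1],
     [2, 3, 2, 1, 3, 2, 3, 2, 3, 1, 3, 2, 3, 2, 3, 2, 3, 2, 3, 1, 3, 2, 1, 2, 3, 1, 3, 2, 3, 2,
     1, 3, 1, 3, 2, 3, 2, 3, 1],
     [1, 2, 3, 1, 3, 1, 2, 3, 2, 3, 2, 3, 1, 3, 2, 3, 2, 1, 2, 3, 2, 3, 2, 3, 1, 3, 1, 2, 3, 1,
     2, 3, 1, 3, 1, 2, 3, 2, 3, 1],
     [2, 1, 2, 1, 2, 3, 2, 1, 3, 2, 3, 2, 1, 2, 1, 2, 3, 2, 3, 2, 3, 2, 3, 1, 2, 3, 2, 1, 2, 3,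
     1, 3, 2, 1, 2, 3, 2, 3, 2, 3, 1],
     [1, 2, 1, 2, 1, 2, 3, 1, 2, 1, 3, 1, 3, 1, 3, 1, 2, 1, 2, 3, 1, 2, 1, 3, 2, 3, 2, 3, 1, 2,
     1, 3, 2, 1, 2, 1, 2, 3, 2, 1, 2, 1],
     [1, 3, 2, 1, 2, 3, 2, 3, 2, 3, 2, 3, 2, 1, 2, 3, 1, 3, 2, 1, 3, 1, 2, 1, 2, 1, 2, 1, 3, 2,
     3, 2, 1, 2, 3, 2, 3, 2, 1, 2, 1, 3, 2],
     [2, 1, 3, 1, 2, 3, 2, 1, 3, 2, 1, 3, 1, 2, 1, 3, 1, 3, 2, 1, 2, 3, 2, 1, 3, 1, 2, 1, 2, 3,
     2, 1, 2, 1, 3, 1, 2, 1, 3, 1, 2, 3, 1, 2],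
     [1, 2, 3, 2, 1, 2, 3, 1, 2, 1, 2, 3, 1, 2, 1, 2, 3, 2, 1, 2, 1, 3, 2, 1, 2, 3, 2, 1, 3, 1,
     2, 1, 2, 1, 2, 1, 3, 1, 3, 1, 2, 1, 2, 1, 2],
     [1, 2, 3, 1, 2, 3, 2, 1, 3, 1, 2, 1, 2, 1, 3, 2, 1, 3, 1, 2, 3, 1, 2, 1, 2, 3, 2, 1, 2, 1,
     3, 1, 3, 2, 3, 2, 1, 2, 1, 2, 1, 2, 3, 1, 3, 2],
     [1, 2, 1, 2, 1, 3, 1, 2, 1, 2, 3, 1, 3, 1, 2, 1, 2, 1, 2, 1, 3, 1, 2, 1, 2, 1, 2, 1, 3, 1,
     3, 2, 1, 2, 1, 3, 1, 2, 1, 2, 1, 3, 2, 1, 3, 1, 2]]"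

lemma words3_closable: "list_all (closable_word 3) words3"
  unfolding words3_def list.pred_inject closable_word_def id_window_def
  by (intro conjI) code_simp+

lemma words3_length: "map length words3 = [7..<48]"
  unfolding words3_def by code_simp

lemma cycle_length_3:
  assumes "8 \<le> l" "l \<le> 48"
  shows "cycle_length 3 l"
proof -
  have "l - 1 \<in> set (map length words3)" using assms unfolding words3_length set_upt by auto
  then obtain ws where "ws \<in> set words3" "Suc (length ws) = l" using assms by fastforce
  then show ?thesis using words3_closable by (auto simp: cycle_length_def list_all_iff)
qed

text \<open>The signed rotation has order 4 here, so alternating the two reversals runs through all
  eight vertices.\<close>

lemma cycle_length_2_8: "cycle_length 2 8"
proof -
  have "closable_word 2 [1,2,1,2,1,2,1]"
    unfolding closable_word_def id_window_def by code_simp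
  then show ?thesis by (auto simp: cycle_length_def intro!: exI[of _ "[1,2,1,2,1,2,1]"])
qed

lemma order_lower_bound: "3 \<le> m \<Longrightarrow> 4 * m + 9 \<le> 2 ^ m * fact m"
proof (induction m rule: dec_induct)
  case (step k)
  have "2 * (2 ^ k * fact k) \<le> (2 ^ Suc k * fact (Suc k) :: nat)"
    by (simp add: algebra_simps)
  then have "2 * (4 * k + 9) \<le> (2 ^ Suc k * fact (Suc k) :: nat)"
    using step.IH by (meson le_trans mult_le_mono2)
  then show ?case by simp
qed (simp add: fact_numeral)

lemma cycle_length_ge_3:
  assumes "3 \<le> m" "8 \<le> l" "l \<le> 2 ^ m * fact m"
  shows "cycle_length m l"
  using assms
proof (induction m arbitrary: l rule: dec_induct)
  case base
  then show ?case by (intro cycle_length_3) (auto simp: fact_numeral)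
next
  case (step m)
  define N where "N = (2 ^ m * fact m :: nat)"
  have N: "4 * m + 9 \<le> N" using order_lower_bound step.hyps by (simp add: N_def)
  show ?case
  proof (cases "l \<le> N")
    case True
    then show ?thesis using step by (intro cycle_length_Suc) (auto simp: N_def)
  next
    case False
    have "l \<le> 2 * Suc m * N" using step.prems(2) by (simp add: N_def algebra_simps)
    then obtain cs where cs: "length cs = 2 * Suc m" "set cs \<subseteq> insert 2 {8..N}" "sum_list cs = l"
      using sum_list_decomposition[of N "2 * Suc m" l] N False step.hyps by auto
    \<comment> \<open>A summand \<open>2\<close> crosses a copy along the edge itself; the others
      come from the induction hypothesis.\<close>
    have "\<forall>c\<in>set cs. cycle_length m c"
      using cs(2) step.IH cycle_length_2[of m] step.hyps by (auto simp: N_def)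
    then show ?thesis using cycle_length_sum_list[OF cs(1)] cs(3) by simp
  qed
qed

lemma cycle_length_ge_2:
  assumes "2 \<le> n" "8 \<le> l" "l \<le> 2 ^ n * fact n"
  shows "cycle_length n l"
proof (cases "n = 2")
  case True
  then have "l = 8" using assms by (simp add: fact_numeral)
  then show ?thesis using cycle_length_2_8 True by simp
next
  case False
  then show ?thesis using assms by (intro cycle_length_ge_3) auto
qed

subsection \<open>From windows to signed permutations\<close>

fun path_arcs :: "(int \<Rightarrow> int) \<Rightarrow> nat list \<Rightarrow> ((int \<Rightarrow> int) \<times> (int \<Rightarrow> int)) list" where
  "path_arcs w [] = []"
| "path_arcs w (i # ws) = (w, prefix_reversal i w) # path_arcs (prefix_reversal i w) ws"

lemma length_path_arcs [simp]: "length (path_arcs w ws) = length ws"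
  by (induction ws arbitrary: w) auto

text \<open>The tails of a closed walk are its vertices without the repetition at the end; the last
  letter contributes only its tail.\<close>

lemma map_fst_path_arcs: "map fst (path_arcs w (ws @ [i])) = pawalk_verts w (path_arcs w ws)"
  by (induction ws arbitrary: w) auto

lemma pawalk_verts_not_Nil [simp]: "pawalk_verts w p \<noteq> []"
  by (cases p) auto

lemma pawalk_verts_snoc:
  "pawalk_verts w (path_arcs w (ws @ [i])) =
     pawalk_verts w (path_arcs w ws) @ [prefix_reversal i (last (pawalk_verts w (path_arcs w ws)))]"
  by (induction ws arbitrary: w) auto

lemma pcas_path_arcs: "pcas w (path_arcs w ws) (last (pawalk_verts w (path_arcs w ws)))"
  by (induction ws arbitrary: w) auto

lemma path_arcs_subset:
  "\<lbrakk>w \<in> signed_perms n; set ws \<subseteq> {1..n}\<rbrakk> \<Longrightarrow> set (path_arcs w ws) \<subseteq> parcs (burnt_pancake n)"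
  by (induction ws arbitrary: w)
     (use signed_perms_prefix_reversal in \<open>auto simp: burnt_pancake_def\<close>)

lemma pawalk_verts_subset:
  "\<lbrakk>w \<in> signed_perms n; set ws \<subseteq> {1..n}\<rbrakk>
    \<Longrightarrow> set (pawalk_verts w (path_arcs w ws)) \<subseteq> signed_perms n"
  by (induction ws arbitrary: w) (use signed_perms_prefix_reversal in auto)

lemma map_window_pawalk_verts:
  "set ws \<subseteq> {1..n} \<Longrightarrow> map (window n) (pawalk_verts w (path_arcs w ws)) = traj (window n w) ws"
  by (induction ws arbitrary: w) (auto simp: window_prefix_reversal prefix_flip_def)

text \<open>The window gives the values at positive arguments, oddness those at negative ones, and
  elsewhere the function is the identity.\<close>

lemma inj_on_window: "inj_on (window n) (signed_perms n)"
proof (rule inj_onI)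
  fix v w assume vw: "v \<in> signed_perms n" "w \<in> signed_perms n" and eq: "window n v = window n w"
  have pos: "v j = w j" if "1 \<le> j" "j \<le> int n" for j
  proof -
    have "\<forall>i\<in>set [1..<Suc n]. v (int i) = w (int i)" using eq by (simp add: window_def del: upt_Suc)
    then show ?thesis using that by (auto dest!: bspec[of _ _ "nat j"] simp del: upt_Suc)
  qed
  show "v = w"
  proof
    fix j
    consider "j \<notin> pm_interval n" | "1 \<le> j" "j \<le> int n" | "1 \<le> - j" "- j \<le> int n"
      by (force simp: pm_interval_def)
    then show "v j = w j"
    proof cases
      case 1
      then show ?thesis using vw by (auto simp: signed_perms_def permutes_def)
    next
      case 3
      then have "- j \<in> pm_interval n" by (auto simp: pm_interval_def)
      then have "v (- (- j)) = - v (- j)" "w (- (- j)) = - w (- j)"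
        using vw unfolding signed_perms_def by blast+
      then show ?thesis using pos[of "- j"] 3 by simp
    qed (rule pos)
  qed
qed

lemma id_signed_perm: "id \<in> signed_perms n"
  by (simp add: signed_perms_def permutes_id)

lemma window_id: "window n id = id_window n"
  by (simp add: window_def id_window_def)

section \<open>Counting signed permutations\<close>

lemma window_signed_perm:
  assumes "w \<in> signed_perms n"
  shows "map abs (window n w) \<in> permutations_of_set {1..int n}"
proof -
  have perm: "w permutes pm_interval n" and odd: "\<And>i. i \<in> pm_interval n \<Longrightarrow> w (- i) = - w i"
    using assms by (auto simp: signed_perms_def)
  have in_pm: "int j \<in> pm_interval n" if "j \<in> {1..n}" for j
    using that by (auto simp: pm_interval_def)
  have inj: "inj_on (\<lambda>j. \<bar>w (int j)\<bar>) {1..n}"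
  proof (rule inj_onI)
    fix i j assume ij: "i \<in> {1..n}" "j \<in> {1..n}" "\<bar>w (int i)\<bar> = \<bar>w (int j)\<bar>"
    then have "w (int i) = w (int j) \<or> w (int i) = w (- int j)"
      using odd in_pm by (auto simp: abs_eq_iff)
    then have "int i = int j \<or> int i = - int j" using permutes_inj[OF perm] by (auto dest: injD)
    then show "i = j" using ij by auto
  qed
  have dist: "distinct (map abs (window n w))"
    using inj by (simp add: window_def distinct_map o_def atLeastLessThanSuc_atLeastAtMost
        del: upt_Suc)
  have sub: "set (map abs (window n w)) \<subseteq> {1..int n}"
  proof
    fix y assume "y \<in> set (map abs (window n w))"
    then obtain j where j: "j \<in> {1..n}" "y = \<bar>w (int j)\<bar>"
      by (auto simp: window_def less_Suc_eq_le simp del: upt_Suc)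
    have "w (int j) \<in> pm_interval n" using permutes_in_image[OF perm] in_pm j(1) by blast
    then show "y \<in> {1..int n}" using j(2) by (auto simp: pm_interval_def)
  qed
  have "card (set (map abs (window n w))) = n"
    unfolding distinct_card[OF dist] by (simp add: window_def)
  then have "set (map abs (window n w)) = {1..int n}"
    using sub by (intro card_subset_eq) auto
  then show ?thesis using dist by (simp add: permutations_of_set_def)
qed

text \<open>A window is determined by its absolute values and its signs. With this bound, a cycle on
  \<open>2 ^ n * fact n\<close> distinct vertices must visit all of them.\<close>

lemma card_signed_perms_le: "card (signed_perms n) \<le> 2 ^ n * fact n"
proof -
  let ?S = "{ys. set ys \<subseteq> {-1, 1 :: int} \<and> length ys = n}"
  let ?T = "permutations_of_set {1..int n} \<times> ?S"
  let ?f = "\<lambda>w. (map abs (window n w), map sgn (window n w))"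
  have "inj_on ?f (signed_perms n)"
  proof (rule inj_onI)
    fix v w assume vw: "v \<in> signed_perms n" "w \<in> signed_perms n" and eq: "?f v = ?f w"
    have "map (\<lambda>(a, s). s * a) (zip (map abs xs) (map sgn xs)) = xs" for xs :: "int list"
      by (induction xs) (auto simp: sgn_mult_abs)
    then have "window n v = window n w" using eq by (metis prod.inject)
    then show "v = w" using vw inj_on_window by (meson inj_onD)
  qed
  moreover have "?f w \<in> ?T" if "w \<in> signed_perms n" for w
  proof -
    note p = window_signed_perm[OF that]
    have "0 \<notin> set (map abs (window n w))" using p by (auto simp: permutations_of_set_def)
    then have "0 \<notin> set (window n w)" by force
    then have "map sgn (window n w) \<in> ?S" by (auto simp: sgn_if window_def)
    then show ?thesis using p by blast
  qed
  then have "?f ` signed_perms n \<subseteq> ?T" by blast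
  moreover have "finite ?T" by (intro finite_cartesian_product finite_lists_length_eq) auto
  ultimately have "card (signed_perms n) \<le> card ?T" by (rule card_inj_on_le)
  also have "\<dots> = 2 ^ n * fact n"
    by (simp add: card_cartesian_product card_lists_length_eq flip: numeral_2_eq_2)
  finally show ?thesis .
qed

section \<open>Cycles in the burnt pancake graph\<close>

lemma undirected_cycle_of_cycle_length:
  assumes "cycle_length n l" "3 \<le> l"
  shows "\<exists>p. pre_digraph.undirected_cycle (with_proj (burnt_pancake n)) p \<and> length p = l
           \<and> distinct (map fst p) \<and> fst ` set p \<subseteq> signed_perms n"
proof -
  let ?G = "with_proj (burnt_pancake n)"
  obtain ws where ws: "closable_word n ws" "Suc (length ws) = l"
    using assms(1) by (auto simp: cycle_length_def)
  define p where "p = path_arcs id (ws @ [n])"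
  let ?q = "pawalk_verts id (path_arcs id ws)"
  \<comment> \<open>The length bound makes \<open>ws\<close> nonempty, and its letters lie in
    \<open>{1..n}\<close>.\<close>
  have n: "n \<ge> 1" using ws assms(2) by (cases ws) (auto simp: closable_word_def)
  have set_ws: "set ws \<subseteq> {1..n}" using ws by (simp add: closable_word_def)
  then have set_wsn: "set (ws @ [n]) \<subseteq> {1..n}" using n by auto
  have q: "map (window n) ?q = traj (id_window n) ws"
    using map_window_pawalk_verts[OF set_ws] by (simp add: window_id)
  then have dist: "distinct ?q" using ws(1) by (metis closable_word_def distinct_map)
  have qs: "set ?q \<subseteq> signed_perms n" by (rule pawalk_verts_subset[OF id_signed_perm set_ws])
  have q_ne: "?q \<noteq> []" by (cases ws) auto
  let ?z = "prefix_reversal n (last ?q)"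
  have "last ?q \<in> signed_perms n" using qs q_ne by auto
  then have zs: "?z \<in> signed_perms n" using signed_perms_prefix_reversal n by auto
  have "window n (last ?q) = prefix_flip n (id_window n)"
    using q q_ne ws(1) by (metis closable_word_def last_map)
  then have "window n ?z = prefix_flip n (prefix_flip n (id_window n))"
    by (simp add: window_prefix_reversal prefix_flip_def)
  then have "window n ?z = window n id" by (simp add: prefix_flip_prefix_flip window_id)
  \<comment> \<open>The closing flip undoes the full flip at the end of the word; equal windows then
    give equal signed permutations.\<close>
  then have z: "?z = id" using zs id_signed_perm inj_on_window by (meson inj_onD)
  have verts: "pawalk_verts id p = ?q @ [id]" unfolding p_def pawalk_verts_snoc z ..
  have "pcas id p id" using pcas_path_arcs[of id "ws @ [n]"] verts by (simp add: p_def)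
  moreover have "set p \<subseteq> parcs (burnt_pancake n)"
    unfolding p_def by (rule path_arcs_subset[OF id_signed_perm set_wsn])
  ultimately have "pre_digraph.awalk ?G id p id"
    unfolding pre_digraph.awalk_def cas_with_proj_eq with_proj_simps
    by (simp add: burnt_pancake_def id_signed_perm)
  \<comment> \<open>Dropping the initial \<open>id\<close> leaves the other vertices of
    \<open>?q\<close> and the final \<open>id\<close>.\<close>
  moreover have "distinct (tl (pawalk_verts id p))"
    unfolding verts using dist by (cases ws) auto
  moreover have len: "length p = l" by (simp add: p_def ws(2))
  then have "p \<noteq> []" using assms(2) by auto
  ultimately have "pre_digraph.cycle ?G p"
    unfolding pre_digraph.cycle_def awalk_verts_with_proj_eq by blast
  then have "pre_digraph.undirected_cycle ?G p"
    using assms(2) len by (simp add: pre_digraph.undirected_cycle_def)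
  moreover have fst: "map fst p = ?q" by (simp add: p_def map_fst_path_arcs)
  moreover have "fst ` set p \<subseteq> signed_perms n" using qs unfolding fst[symmetric] by simp
  ultimately show ?thesis using len dist by metis
qed

theorem theorem3p14:
  fixes n :: nat
  assumes "n \<ge> 2"
  shows "(\<forall>l::nat. 8 \<le> l \<and> l \<le> 2 ^ n * fact n \<longrightarrow>
            (\<exists>p. pre_digraph.undirected_cycle (with_proj (burnt_pancake n)) p \<and> length p = l))
       \<and> (\<exists>p. pre_digraph.hamiltonian_cycle (with_proj (burnt_pancake n)) p)"
proof (intro conjI allI impI)
  fix l :: nat assume "8 \<le> l \<and> l \<le> 2 ^ n * fact n"
  then show "\<exists>p. pre_digraph.undirected_cycle (with_proj (burnt_pancake n)) p \<and> length p = l"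
    using undirected_cycle_of_cycle_length[of n l] cycle_length_ge_2[of n l] assms by auto
next
  \<comment> \<open>The order of the graph must itself be an admissible cycle length.\<close>
  have "8 \<le> 2 ^ n * (fact n :: nat)"
  proof (cases "n = 2")
    case False
    then show ?thesis using order_lower_bound[of n] assms by simp
  qed (simp add: fact_numeral)
  then obtain p where p: "pre_digraph.undirected_cycle (with_proj (burnt_pancake n)) p"
    "length p = 2 ^ n * fact n" "distinct (map fst p)" "fst ` set p \<subseteq> signed_perms n"
    using undirected_cycle_of_cycle_length[of n "2 ^ n * fact n"] cycle_length_ge_2[of n] assms
    by auto
  have "card (fst ` set p) = 2 ^ n * fact n"
    using distinct_card[OF p(3)] p(2) by simp
  moreover have "finite (signed_perms n)"
    by (rule finite_subset[OF _ finite_permutations[of "pm_interval n"]])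
       (auto simp: signed_perms_def pm_interval_def)
  ultimately have "fst ` set p = signed_perms n"
    using p(4) card_signed_perms_le[of n] by (intro card_seteq) auto
  then show "\<exists>p. pre_digraph.hamiltonian_cycle (with_proj (burnt_pancake n)) p"
    using p(1) by (intro exI[of _ p])
      (simp add: pre_digraph.hamiltonian_cycle_def burnt_pancake_def)
qed

end
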